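(* Let $(E,d)$ be a metric space, $Z\in E$ a random variable and $\Lambda_1,\dots,\Lambda_n:E\to\mathbb R_+$ measurable. Assume there exist $\alpha,\beta_1,\dots,\beta_n\in\mathcal M_{\mathbb P_+}$ such that, for every $1$-Lipschitz $f:E\to\mathbb R$ and independent copy $Z'$ of $Z$, $$S_{|f(Z)-f(Z')|}\le\alpha\qquad\text{and}\qquad \forall k\in\{1,\dots,n\}:\ S_{\Lambda_k(Z)}\le\beta_k.$$ Let $(E',d')$ be another metric space and $\Phi:E\to E'$ such that for all $z,z'\in E$, $$d'(\Phi(z),\Phi(z'))\le\max(\Lambda_1(z),\Lambda_1(z'))\cdots\max(\Lambda_n(z),\Lambda_n(z'))\cdot d(z,z').$$ Then for any $1$-Lipschitz $g:E'\to\mathbb R$, $$S_{|g(\Phi(Z))-g(\Phi(Z'))|}\le(2n+1)\cdot\alpha\boxtimes\beta_1\boxtimes\cdots\boxtimes\beta_n.$$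
   Context: Operators. An operator is a map $f:\mathbb R\to2^{\mathbb R}$, with graph $\{(x,y):y\in f(x)\}$, $\mathrm{Dom}(f)=\{x:f(x)\ne\emptyset\}$, $\mathrm{Ran}(f)=\bigcup_xf(x)$; its inverse is defined by $x\in f^{-1}(y)\iff y\in f(x)$. Products are pointwise Minkowski products: $(f\cdot g)(x)=\{ab:a\in f(x),b\in g(x)\}$; for $\lambda\in\mathbb R$, $(\lambda f)(x)=\{\lambda y:y\in f(x)\}$. The parallel product is $f\boxtimes g=(f^{-1}\cdot g^{-1})^{-1}$ (commutative, associative). Monotonicity. $f$ is nondecreasing if $(y-x)(v-u)\ge0$ for all $(x,u),(y,v)$ in its graph; nonincreasing if $-f$ is nondecreasing. A monotone (nondecreasing or nonincreasing) operator is maximally monotone if its graph is not strictly contained in that of another monotone operator. $\mathcal M_\downarrow$ is the set of maximally monotone nonincreasing operators. Order on $\mathcal M_\downarrow$. The resolvent of $f\in\mathcal M_\downarrow$ is $J_f=(\mathrm{Id}-f)^{-1}$, a single-valued function defined on all of $\mathbb R$; for $f,g\in\mathcal M_\downarrow$, $f\le g$ means $J_f(x)\le J_g(x)$ for all $x\in\mathbb R$. Probabilistic operators. $\mathcal M_{\mathbb P_+}$ is the set of $\alpha\in\mathcal M_\downarrow$ with $\mathrm{Dom}(\alpha)\subset\mathbb R_+$, $\mathrm{Ran}(\alpha)\subset\mathbb R_+$, and such that $\mathrm{Ran}(\alpha)$ contains a (strictly) increasing sequence converging to $1$. For a real random variable $X$, $S_X(t)=[\mathbb P(X>t),\mathbb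 P(X\ge t)]$, $t\in\mathbb R$; $S_X\in\mathcal M_\downarrow$. For $\gamma\in\mathcal M_\downarrow$ with $\mathrm{Dom}(\gamma),\mathrm{Ran}(\gamma)\subset\mathbb R_+$, $S_X\le\gamma$ is equivalent to: $\mathbb P(X>t)\le u$ for all $t\in\mathrm{Dom}(\gamma)$ and all $u\in\gamma(t)$. If in a degenerate case the right-hand side of the conclusion is not maximally monotone, the inequality is read in this latter form. *)

theory Defs
  imports "HOL-Probability.Probability" "HOL-Library.Set_Algebras"
begin

text \<open>An operator is a set-valued map on the real line, possibly empty-valued.\<close>

type_synonym operator = "real \<Rightarrow> real set"

definition op_graph :: "operator \<Rightarrow> (real \<times> real) set" where
  "op_graph f = {(x, y). y \<in> f x}"

definition op_Dom :: "operator \<Rightarrow> real set" where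
  "op_Dom f = {x. f x \<noteq> {}}"

definition op_Ran :: "operator \<Rightarrow> real set" where
  "op_Ran f = (\<Union>x. f x)"

definition op_inv :: "operator \<Rightarrow> operator" where
  "op_inv f y = {x. y \<in> f x}"

text \<open>On the right, \<open>*\<close> is the Minkowski product of sets (HOL-Library.Set_Algebras).\<close>

definition op_times :: "operator \<Rightarrow> operator \<Rightarrow> operator" where
  "op_times f g x = f x * g x"

definition op_scale :: "real \<Rightarrow> operator \<Rightarrow> operator" where
  "op_scale c f x = (\<lambda>y. c * y) ` f x"

definition op_par :: "operator \<Rightarrow> operator \<Rightarrow> operator" (infixl "\<boxtimes>" 70) where
  "f \<boxtimes> g = op_inv (op_times (op_inv f) (op_inv g))"


definition op_nondecreasing :: "operator \<Rightarrow> bool" where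
  "op_nondecreasing f \<longleftrightarrow>
     (\<forall>(x, u) \<in> op_graph f. \<forall>(y, v) \<in> op_graph f. (y - x) * (v - u) \<ge> 0)"

definition op_nonincreasing :: "operator \<Rightarrow> bool" where
  "op_nonincreasing f \<longleftrightarrow> op_nondecreasing (op_scale (-1) f)"

definition op_monotone :: "operator \<Rightarrow> bool" where
  "op_monotone f \<longleftrightarrow> op_nondecreasing f \<or> op_nonincreasing f"

definition op_maximally_monotone :: "operator \<Rightarrow> bool" where
  "op_maximally_monotone f \<longleftrightarrow>
     op_monotone f \<and> \<not> (\<exists>g. op_monotone g \<and> op_graph f \<subset> op_graph g)"

definition M_down :: "operator set" where
  "M_down = {f. op_maximally_monotone f \<and> op_nonincreasing f}"


definition op_Id_minus :: "operator \<Rightarrow> operator" where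
  "op_Id_minus f x = (\<lambda>u. x - u) ` f x"

text \<open>For \<open>f \<in> M_down\<close> the operator \<open>op_inv (op_Id_minus f)\<close> is everywhere defined and
  single-valued; the description operator extracts its unique value. Hence \<open>resolvent\<close> and
  \<open>op_le\<close> are meaningful only on \<open>M_down\<close>.\<close>

definition resolvent :: "operator \<Rightarrow> real \<Rightarrow> real" where
  "resolvent f x = (THE y. y \<in> op_inv (op_Id_minus f) x)"

definition op_le :: "operator \<Rightarrow> operator \<Rightarrow> bool" where
  "op_le f g \<longleftrightarrow> (\<forall>x. resolvent f x \<le> resolvent g x)"


definition M_prob_pos :: "operator set" where
  "M_prob_pos = {\<alpha> \<in> M_down. op_Dom \<alpha> \<subseteq> {0..} \<and> op_Ran \<alpha> \<subseteq> {0..} \<and>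
     (\<exists>s :: nat \<Rightarrow> real. strict_mono s \<and> range s \<subseteq> op_Ran \<alpha> \<and> s \<longlonglongrightarrow> 1)}"

definition survival_op :: "'w measure \<Rightarrow> ('w \<Rightarrow> real) \<Rightarrow> operator" where
  "survival_op M X t = {\<P>(\<omega> in M. X \<omega> > t) .. \<P>(\<omega> in M. X \<omega> \<ge> t)}"

text \<open>The inequality between the survival operator of \<open>X\<close> and an operator \<open>\<gamma>\<close>, also for
  \<open>\<gamma> \<notin> M_down\<close>, where the order \<open>op_le\<close> is not available and the inequality is read as a
  pointwise tail bound.\<close>

definition survival_le :: "'w measure \<Rightarrow> ('w \<Rightarrow> real) \<Rightarrow> operator \<Rightarrow> bool" where
  "survival_le M X \<gamma> \<longleftrightarrow>
     (if \<gamma> \<in> M_down then op_le (survival_op M X) \<gamma>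
      else \<forall>t \<in> op_Dom \<gamma>. \<forall>u \<in> \<gamma> t. \<P>(\<omega> in M. X \<omega> > t) \<le> u)"

definition indep_copy :: "'w measure \<Rightarrow> ('w \<Rightarrow> 'e::metric_space) \<Rightarrow> ('w \<Rightarrow> 'e) \<Rightarrow> bool" where
  "indep_copy M Z Z' \<longleftrightarrow>
     Z' \<in> measurable M borel \<and> prob_space.indep_var M borel Z borel Z' \<and>
     distr M borel Z' = distr M borel Z"

end

theory Submission
  imports Defs
begin

text \<open>
  Let \<open>w \<in> \<alpha> a\<close> and \<open>w \<in> \<beta>\<^sub>k b\<^sub>k\<close> for all \<open>k\<close>, and let \<open>A\<close> be the set where \<open>\<Lambda>\<^sub>k \<le> b\<^sub>k\<close> for all \<open>k\<close>. On
  \<open>A\<close> the map \<open>g \<circ> \<Phi>\<close> is Lipschitz with constant \<open>L = b\<^sub>1 \<cdots> b\<^sub>n\<close>, so it agrees on \<open>A\<close> with some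
  \<open>L\<close>-Lipschitz \<open>h\<close> defined everywhere. Hence \<open>|g (\<Phi> Z) - g (\<Phi> Z')| > a L\<close> forces \<open>Z \<notin> A\<close> or
  \<open>Z' \<notin> A\<close> (each of probability at most \<open>n w\<close>) or \<open>|h Z - h Z'| > a L\<close> (of probability at most
  \<open>w\<close>). The resolvent order is translated into such tail bounds by intersecting the
  graphs with lines of slope one, which is Minty's theorem in dimension one.
\<close>

section \<open>Resolvents and tail bounds\<close>

lemma op_nonincreasing_iff:
  "op_nonincreasing f \<longleftrightarrow>
     (\<forall>x u y v. u \<in> f x \<longrightarrow> v \<in> f y \<longrightarrow> (y - x) * (v - u) \<le> 0)"
proof -
  have "(y - x) * (- v - - u) \<ge> 0 \<longleftrightarrow> (y - x) * (v - u) \<le> 0" for x y u v :: real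
    by (simp add: algebra_simps)
  then show ?thesis
    unfolding op_nonincreasing_def op_nondecreasing_def op_graph_def op_scale_def
    by (auto simp del: diff_minus_eq_add minus_diff_minus) blast+
qed

text \<open>Geometrically, the resolvent at \<open>x\<close> is the abscissa at which the graph of
  \<open>f\<close> meets the line of slope one through \<open>(x, 0)\<close>.\<close>

lemma mem_inv_Id_minus: "y \<in> op_inv (op_Id_minus f) x \<longleftrightarrow> y - x \<in> f y"
  unfolding op_inv_def op_Id_minus_def by (auto simp: image_iff intro!: bexI[of _ "y - x"])

text \<open>Two points on a line of slope one have equal increments in both coordinates, so
  monotonicity makes the square of that increment nonpositive.\<close>

lemma resolvent_eqI:
  assumes "op_nonincreasing f" "y - x \<in> f y"
  shows "resolvent f x = y"
  unfolding resolvent_def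
proof (rule the_equality)
  show "y \<in> op_inv (op_Id_minus f) x"
    using assms(2) by (simp add: mem_inv_Id_minus)
next
  fix z assume "z \<in> op_inv (op_Id_minus f) x"
  then have "(z - y) * ((z - x) - (y - x)) \<le> 0"
    using assms unfolding mem_inv_Id_minus op_nonincreasing_iff by blast
  then have "(z - y)\<^sup>2 \<le> 0"
    by (simp add: power2_eq_square)
  then show "z = y"
    by simp
qed

text \<open>A point related to every point of the graph could be added to it without losing
  monotonicity, so by maximality it is already there.\<close>

lemma M_down_memI:
  assumes "f \<in> M_down" and rel: "\<And>p q. q \<in> f p \<Longrightarrow> (y - p) * (v - q) \<le> 0"
  shows "v \<in> f y"
proof (rule ccontr)
  assume v: "v \<notin> f y"
  let ?g = "f(y := insert v (f y))"
  have f: "op_nonincreasing f"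
    using assms(1) by (simp add: M_down_def)
  have rel': "(p - y) * (q - v) \<le> 0" if "q \<in> f p" for p q
    using rel[OF that] by (simp add: algebra_simps)
  have "op_nonincreasing ?g"
    unfolding op_nonincreasing_iff
  proof (intro allI impI)
    fix p q p' q' assume "q \<in> ?g p" "q' \<in> ?g p'"
    then have "q \<in> f p \<or> (p = y \<and> q = v)" "q' \<in> f p' \<or> (p' = y \<and> q' = v)"
      by (auto split: if_splits)
    then show "(p' - p) * (q' - q) \<le> 0"
      using f[unfolded op_nonincreasing_iff] rel rel' by fastforce
  qed
  moreover have "op_graph f \<subset> op_graph ?g"
    using v unfolding op_graph_def by (auto split: if_splits)
  ultimately show False
    using assms(1) unfolding M_down_def op_maximally_monotone_def op_monotone_def by blast
qed

text \<open>A point \<open>(y, y - x)\<close> of the line is related to \<open>(p, q)\<close>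
  exactly when \<open>y\<close> lies between \<open>p\<close> and \<open>x + q\<close>. Monotonicity
  makes these intervals meet pairwise; as in Helly's theorem on the line, the supremum of their left
  ends lies in all of them.\<close>

lemma M_down_meets_line:
  assumes "f \<in> M_down"
  obtains y where "y - x \<in> f y"
proof -
  define G where "G = op_graph f"
  \<comment> \<open>If the graph were empty, every point would be vacuously related to it.\<close>
  have "\<exists>p q. q \<in> f p"
    using M_down_memI[OF assms] by blast
  then obtain p0 q0 where G0: "(p0, q0) \<in> G"
    unfolding G_def op_graph_def by auto
  have cross: "min p (x + q) \<le> max p' (x + q')" if "(p, q) \<in> G" "(p', q') \<in> G" for p q p' q'
  proof (cases "p \<le> p'")
    case False
    have "(p - p') * (q - q') \<le> 0"
      using assms that unfolding M_down_def G_def op_graph_def op_nonincreasing_iff by blast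
    with False have "q \<le> q'"
      by (simp add: mult_le_0_iff)
    then show ?thesis by simp
  qed simp
  define y where "y = (SUP (p, q) \<in> G. min p (x + q))"
  have "bdd_above ((\<lambda>(p, q). min p (x + q)) ` G)"
    by (rule bdd_aboveI2[where M = "max p0 (x + q0)"]) (use cross G0 in auto)
  then have lower: "min p (x + q) \<le> y" if "(p, q) \<in> G" for p q
    unfolding y_def using cSUP_upper[OF that] by fastforce
  have upper: "y \<le> max p (x + q)" if "(p, q) \<in> G" for p q
    unfolding y_def by (rule cSUP_least) (use cross that G0 in auto)
  have "y - x \<in> f y"
  proof (rule M_down_memI[OF assms])
    fix p q assume "q \<in> f p"
    then have "(p, q) \<in> G" by (simp add: G_def op_graph_def)
    from lower[OF this] upper[OF this] show "(y - p) * (y - x - q) \<le> 0"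
      by (auto simp: mult_le_0_iff)
  qed
  then show ?thesis by (rule that)
qed

section \<open>Survival operators and their comparison with maximally monotone ones\<close>

context prob_space
begin

text \<open>The line rises and the tail probability falls, so they cross; a jump of the tail is
  filled by the interval that \<open>survival_op\<close> takes as its value.\<close>

lemma survival_op_meets_line:
  assumes [measurable]: "X \<in> borel_measurable M"
  obtains y where "y - x \<in> survival_op M X y"
proof -
  define D where "D = distr M borel X"
  interpret D: real_distribution D
    unfolding D_def by (rule real_distribution_distr) simp
  have gt: "\<P>(\<omega> in M. X \<omega> > t) = 1 - cdf D t" for t
  proof -
    have "cdf D t = \<P>(\<omega> in M. X \<omega> \<le> t)"
      unfolding D_def cdf_def by (subst measure_distr) (auto intro!: arg_cong[where f = prob])
    moreover have "\<P>(\<omega> in M. \<not> X \<omega> \<le> t) = 1 - \<P>(\<omega> in M. X \<omega> \<le> t)"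
      by (rule prob_neg) simp
    ultimately show ?thesis by (simp add: not_le)
  qed
  have ge: "\<P>(\<omega> in M. X \<omega> \<ge> t) = 1 - measure D {..<t}" for t
  proof -
    have "measure D {..<t} = \<P>(\<omega> in M. X \<omega> < t)"
      unfolding D_def by (subst measure_distr) (auto intro!: arg_cong[where f = prob])
    moreover have "\<P>(\<omega> in M. \<not> X \<omega> < t) = 1 - \<P>(\<omega> in M. X \<omega> < t)"
      by (rule prob_neg) simp
    ultimately show ?thesis by (simp add: not_less)
  qed
  \<comment> \<open>\<open>T\<close> collects the points where the line is not yet above the tail.
    It contains \<open>x\<close>, where the line has height 0, and is bounded by
    \<open>x + 1\<close>, since the tail is at most 1.\<close>
  define T where "T = {t. t - x \<le> 1 - cdf D t}"
  define y where "y = Sup T"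
  have ne: "x \<in> T"
    unfolding T_def using D.cdf_bounded_prob[of x] by simp
  have bdd: "bdd_above T"
  proof (rule bdd_aboveI)
    fix t assume "t \<in> T"
    then show "t \<le> x + 1"
      using D.cdf_nonneg[of t] by (simp add: T_def)
  qed
  have above: "1 - cdf D t \<le> t - x" if "y < t" for t
    using that cSup_upper[OF _ bdd, of t] unfolding y_def T_def by force
  have below: "t - x \<le> 1 - cdf D t" if "t < y" for t
  proof -
    obtain s where s: "s \<in> T" "t < s"
      using less_cSupD[of T t] \<open>t < y\<close> ne unfolding y_def by blast
    then show ?thesis
      unfolding T_def using D.cdf_nondecreasing[of t s] by simp
  qed
  have "1 - cdf D y \<le> y - x"
  proof (rule tendsto_le[OF trivial_limit_at_right_real])
    show "((\<lambda>t. t - x) \<longlongrightarrow> y - x) (at_right y)"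
      by (intro tendsto_intros)
    show "((\<lambda>t. 1 - cdf D t) \<longlongrightarrow> 1 - cdf D y) (at_right y)"
      using D.cdf_is_right_cont[of y] unfolding continuous_within by (intro tendsto_intros)
    show "\<forall>\<^sub>F t in at_right y. 1 - cdf D t \<le> t - x"
      by (rule eventually_at_rightI[of y "y + 1"]) (use above in auto)
  qed
  \<comment> \<open>The limit from the right gave the lower end of the interval at \<open>y\<close>;
    from the left the cdf tends to the mass of the open half-line, which gives the upper
    end.\<close>
  moreover have "y - x \<le> 1 - measure D {..<y}"
  proof (rule tendsto_le[OF trivial_limit_at_left_real])
    show "((\<lambda>t. t - x) \<longlongrightarrow> y - x) (at_left y)"
      by (intro tendsto_intros)
    show "((\<lambda>t. 1 - cdf D t) \<longlongrightarrow> 1 - measure D {..<y}) (at_left y)"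
      using D.cdf_at_left[of y] by (intro tendsto_intros)
    show "\<forall>\<^sub>F t in at_left y. t - x \<le> 1 - cdf D t"
      by (rule eventually_at_leftI[of "y - 1"]) (use below in auto)
  qed
  ultimately have "y - x \<in> survival_op M X y"
    unfolding survival_op_def gt ge by simp
  then show ?thesis by (rule that)
qed

lemma op_nonincreasing_survival_op:
  assumes [measurable]: "X \<in> borel_measurable M"
  shows "op_nonincreasing (survival_op M X)"
proof -
  have le: "v \<le> u" if "u \<in> survival_op M X x" "v \<in> survival_op M X y" "x < y" for x y u v
  proof -
    have "\<P>(\<omega> in M. X \<omega> \<ge> y) \<le> \<P>(\<omega> in M. X \<omega> > x)"
      using \<open>x < y\<close> by (intro finite_measure_mono) auto
    with that show ?thesis
      by (simp add: survival_op_def)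
  qed
  show ?thesis
    unfolding op_nonincreasing_iff
  proof (intro allI impI)
    fix x u y v assume "u \<in> survival_op M X x" "v \<in> survival_op M X y"
    with le[of u x v y] le[of v y u x] show "(y - x) * (v - u) \<le> 0"
      by (cases x y rule: linorder_cases) (auto simp: mult_le_0_iff)
  qed
qed

text \<open>Both resolvents at \<open>x\<close> are crossing abscissas with the same line, so the
  order says that along each such line the survival graph is met no later than \<gamma>.\<close>

lemma op_le_survival_op_iff:
  assumes X[measurable]: "X \<in> borel_measurable M" and \<gamma>: "\<gamma> \<in> M_down"
  shows "op_le (survival_op M X) \<gamma> \<longleftrightarrow> (\<forall>t. \<forall>u \<in> \<gamma> t. \<P>(\<omega> in M. X \<omega> > t) \<le> u)"
proof (intro iffI allI ballI)
  have noninc: "op_nonincreasing \<gamma>"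
    using \<gamma> by (simp add: M_down_def)
  note res_X = resolvent_eqI[OF op_nonincreasing_survival_op[OF X]]
  note res_\<gamma> = resolvent_eqI[OF noninc]
  {
    fix t u assume le: "op_le (survival_op M X) \<gamma>" and "u \<in> \<gamma> t"
    \<comment> \<open>The parameter \<open>t - u\<close> selects the line through the given graph
      point \<open>(t, u)\<close>.\<close>
    obtain s where s: "s - (t - u) \<in> survival_op M X s"
      using survival_op_meets_line[OF X] .
    have "resolvent \<gamma> (t - u) = t"
      using \<open>u \<in> \<gamma> t\<close> by (intro res_\<gamma>) simp
    with le res_X[OF s] have "s \<le> t"
      unfolding op_le_def by metis
    then have "\<P>(\<omega> in M. X \<omega> > t) \<le> \<P>(\<omega> in M. X \<omega> > s)"
      by (intro finite_measure_mono) auto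
    with s \<open>s \<le> t\<close> show "\<P>(\<omega> in M. X \<omega> > t) \<le> u"
      by (simp add: survival_op_def)
  }
  assume tail: "\<forall>t. \<forall>u \<in> \<gamma> t. \<P>(\<omega> in M. X \<omega> > t) \<le> u"
  show "op_le (survival_op M X) \<gamma>"
    unfolding op_le_def
  proof
    fix x
    obtain s where s: "s - x \<in> survival_op M X s"
      using survival_op_meets_line[OF X] .
    obtain t where t: "t - x \<in> \<gamma> t"
      using M_down_meets_line[OF \<gamma>] .
    have "s \<le> t"
    proof (rule ccontr)
      assume "\<not> s \<le> t"
      then have "\<P>(\<omega> in M. X \<omega> \<ge> s) \<le> \<P>(\<omega> in M. X \<omega> > t)"
        by (intro finite_measure_mono) auto
      moreover have "s - x \<le> \<P>(\<omega> in M. X \<omega> \<ge> s)"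
        using s by (simp add: survival_op_def)
      moreover have "\<P>(\<omega> in M. X \<omega> > t) \<le> t - x"
        using tail t by blast
      ultimately show False
        using \<open>\<not> s \<le> t\<close> by linarith
    qed
    then show "resolvent (survival_op M X) x \<le> resolvent \<gamma> x"
      by (simp add: res_X[OF s] res_\<gamma>[OF t])
  qed
qed

text \<open>The tail bound settles both branches of \<open>survival_le\<close>, so membership of
  \<gamma> in \<open>M_down\<close> need not be decided.\<close>

lemma survival_leI:
  assumes "X \<in> borel_measurable M" "\<And>t u. u \<in> \<gamma> t \<Longrightarrow> \<P>(\<omega> in M. X \<omega> > t) \<le> u"
  shows "survival_le M X \<gamma>"
  using assms by (auto simp: survival_le_def op_le_survival_op_iff)

end

section \<open>Points of an iterated parallel product\<close>

text \<open>The parallel product multiplies abscissas at a common height \<open>w\<close>, so each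
  new factor contributes one more abscissa to the product.\<close>

lemma foldl_op_par_memD:
  assumes "w \<in> foldl (\<boxtimes>) \<alpha> (map \<beta> [1..<n+1]) t"
  shows "\<exists>a b. w \<in> \<alpha> a \<and> (\<forall>k\<in>{1..n}. w \<in> \<beta> k (b k)) \<and> t = a * (\<Prod>k=1..n. b k)"
  using assms
proof (induction n arbitrary: t)
  case 0
  then show ?case by auto
next
  case (Suc n)
  have "[1..<Suc n + 1] = [1..<n+1] @ [Suc n]"
    by simp
  with Suc.prems have "w \<in> (foldl (\<boxtimes>) \<alpha> (map \<beta> [1..<n+1]) \<boxtimes> \<beta> (Suc n)) t"
    by (simp only: map_append foldl_append list.map foldl.simps)
  then obtain s c where s: "w \<in> foldl (\<boxtimes>) \<alpha> (map \<beta> [1..<n+1]) s" and c: "w \<in> \<beta> (Suc n) c"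
      and t: "t = s * c"
    by (auto simp del: upt_Suc simp: op_par_def op_inv_def op_times_def set_times_def)
  from Suc.IH[OF s] obtain a b where ab: "w \<in> \<alpha> a" "\<forall>k\<in>{1..n}. w \<in> \<beta> k (b k)"
      "s = a * (\<Prod>k=1..n. b k)"
    by blast
  have "(\<Prod>k=1..n. (b(Suc n := c)) k) = (\<Prod>k=1..n. b k)"
    by (intro prod.cong) auto
  then have "t = a * (\<Prod>k=1..Suc n. (b(Suc n := c)) k)"
    by (simp add: t ab(3))
  moreover have "\<forall>k\<in>{1..Suc n}. w \<in> \<beta> k ((b(Suc n := c)) k)"
    using ab(2) c by (auto simp: le_Suc_eq)
  ultimately show ?case
    using ab(1) by blast
qed

section \<open>Lipschitz extension and measurability\<close>

text \<open>This is McShane's extension, an infimum of cones of slope \<open>L\<close> with apexes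
  on the graph of \<open>f\<close>. For empty \<open>A\<close> there are no cones, and the zero
  function serves.\<close>

lemma lipschitz_on_extend_real:
  fixes f :: "'a::metric_space \<Rightarrow> real"
  assumes f: "L-lipschitz_on A f"
  obtains h where "L-lipschitz_on UNIV h" "\<And>x. x \<in> A \<Longrightarrow> h x = f x"
proof (cases "A = {}")
  case True
  have "L-lipschitz_on UNIV (\<lambda>x::'a. 0::real)"
    using lipschitz_on_nonneg[OF f] by (auto intro: lipschitz_onI)
  with True show ?thesis by (intro that) auto
next
  case False
  have L: "L \<ge> 0"
    using lipschitz_on_nonneg[OF f] .
  have f_le: "f x \<le> f y + L * dist x y" if "x \<in> A" "y \<in> A" for x y
    using lipschitz_onD[OF f that] by (simp add: dist_real_def)
  have tri: "L * dist x y \<le> L * dist x z + L * dist z y" for x y z :: 'a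
    using mult_left_mono[OF dist_triangle[of x y z] L] by (simp add: distrib_left)
  define h where "h x = (INF y\<in>A. f y + L * dist x y)" for x
  obtain y0 where y0: "y0 \<in> A" using False by blast
  have bdd: "bdd_below ((\<lambda>y. f y + L * dist x y) ` A)" for x
  proof (rule bdd_belowI2)
    fix y assume "y \<in> A"
    then show "f y0 - L * dist x y0 \<le> f y + L * dist x y"
      using f_le[OF y0 \<open>y \<in> A\<close>] tri[of y0 y x] by (simp add: dist_commute)
  qed
  have h_le: "h x \<le> h z + L * dist x z" for x z
  proof -
    have "h x - L * dist x z \<le> h z"
      unfolding h_def[of z]
    proof (rule cINF_greatest[OF False])
      fix y assume "y \<in> A"
      then have "h x \<le> f y + L * dist x y"
        unfolding h_def by (rule cINF_lower[OF bdd])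
      then show "h x - L * dist x z \<le> f y + L * dist z y"
        using tri[of x y z] by linarith
    qed
    then show ?thesis by linarith
  qed
  show ?thesis
  proof
    show "L-lipschitz_on UNIV h"
    proof (rule lipschitz_onI[OF _ L])
      fix x z
      show "dist (h x) (h z) \<le> L * dist x z"
        using h_le[of x z] h_le[of z x] by (simp add: dist_real_def dist_commute abs_le_iff)
    qed
  next
    fix x assume x: "x \<in> A"
    have "f x \<le> h x"
      unfolding h_def by (rule cINF_greatest[OF False]) (rule f_le[OF x])
    moreover have "h x \<le> f x"
      unfolding h_def using cINF_lower[OF bdd x, of x] by simp
    ultimately show "h x = f x" by simp
  qed
qed

lemma borel_measurable_lipschitz:
  fixes f :: "'a::metric_space \<Rightarrow> 'b::metric_space"
  assumes "L-lipschitz_on UNIV f"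
  shows "f \<in> borel_measurable borel"
  using lipschitz_on_continuous_on[OF assms] by (rule borel_measurable_continuous_onI)

text \<open>On the sublevel set each maximum is at most \<open>b k\<close>. The bounds
  \<open>b k\<close> will be abscissas of the \<open>\<beta> k\<close>, or a common integer when
  measurability is at stake.\<close>

lemma lipschitz_on_sublevel:
  fixes \<phi> :: "'a::metric_space \<Rightarrow> real"
  assumes \<Lambda>: "\<And>k z. k \<in> I \<Longrightarrow> \<Lambda> k z \<ge> 0"
    and \<phi>: "\<And>z z'. dist (\<phi> z) (\<phi> z') \<le> (\<Prod>k\<in>I. max (\<Lambda> k z) (\<Lambda> k z')) * dist z z'"
    and b: "\<And>k. k \<in> I \<Longrightarrow> b k \<ge> 0"
  shows "(\<Prod>k\<in>I. b k)-lipschitz_on {z. \<forall>k\<in>I. \<Lambda> k z \<le> b k} \<phi>"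
proof (rule lipschitz_onI)
  show "0 \<le> (\<Prod>k\<in>I. b k)"
    using b by (rule prod_nonneg)
next
  fix z z' assume "z \<in> {z. \<forall>k\<in>I. \<Lambda> k z \<le> b k}" "z' \<in> {z. \<forall>k\<in>I. \<Lambda> k z \<le> b k}"
  then have "(\<Prod>k\<in>I. max (\<Lambda> k z) (\<Lambda> k z')) \<le> (\<Prod>k\<in>I. b k)"
    using \<Lambda> by (intro prod_mono) (auto simp: le_max_iff_disj)
  then show "dist (\<phi> z) (\<phi> z') \<le> (\<Prod>k\<in>I. b k) * dist z z'"
    using \<phi>[of z z'] by (meson mult_right_mono order_trans zero_le_dist)
qed

text \<open>The space is a countable union of Borel sublevel sets, on each of which \<open>\<phi>\<close> is Lipschitz.\<close>

lemma borel_measurable_lipschitz_sublevels: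
  fixes \<phi> :: "'a::metric_space \<Rightarrow> real"
  assumes "finite I"
    and [measurable]: "\<And>k. k \<in> I \<Longrightarrow> \<Lambda> k \<in> borel_measurable borel"
    and \<Lambda>: "\<And>k z. k \<in> I \<Longrightarrow> \<Lambda> k z \<ge> 0"
    and \<phi>: "\<And>z z'. dist (\<phi> z) (\<phi> z') \<le> (\<Prod>k\<in>I. max (\<Lambda> k z) (\<Lambda> k z')) * dist z z'"
  shows "\<phi> \<in> borel_measurable borel"
proof -
  define A where "A m = {z. \<forall>k\<in>I. \<Lambda> k z \<le> real m}" for m
  show ?thesis
  proof (rule measurable_piecewise_restrict[of "range A"])
    show "countable (range A)" by simp
  next
    fix S assume "S \<in> range A"
    then obtain m where S: "S = A m" by blast
    have "{z \<in> space borel. \<forall>k\<in>I. \<Lambda> k z \<le> real m} \<in> sets borel"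
      using \<open>finite I\<close> by measurable
    then show "S \<inter> space borel \<in> sets borel"
      by (simp add: S A_def)
    have "(\<Prod>k\<in>I. real m)-lipschitz_on (A m) \<phi>"
      unfolding A_def using lipschitz_on_sublevel[OF \<Lambda> \<phi>, of "\<lambda>_. real m"] by simp
    then show "\<phi> \<in> measurable (restrict_space borel S) borel"
      unfolding S by (intro borel_measurable_continuous_on_restrict lipschitz_on_continuous_on)
  next
    show "space borel \<subseteq> \<Union> (range A)"
    proof
      fix z :: 'a
      \<comment> \<open>As the values are nonnegative, their sum dominates each of them, so one
        \<open>m\<close> works for all \<open>k\<close>.\<close>
      obtain m where m: "(\<Sum>k\<in>I. \<Lambda> k z) \<le> real m"
        using real_arch_simple by blast
      have "\<Lambda> k z \<le> real m" if "k \<in> I" for k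
        using member_le_sum[OF that, of "\<lambda>k. \<Lambda> k z"] \<Lambda> \<open>finite I\<close> m by force
      then show "z \<in> \<Union> (range A)"
        by (auto simp: A_def)
    qed
  qed
qed

section \<open>Concentration of the transported observable\<close>

theorem theorem2p21:
  fixes M :: "'w measure"
    and Z :: "'w \<Rightarrow> 'e::metric_space"
    and n :: nat
    and \<Lambda> :: "nat \<Rightarrow> 'e \<Rightarrow> real"
    and \<alpha> :: operator
    and \<beta> :: "nat \<Rightarrow> operator"
    and \<Phi> :: "'e \<Rightarrow> 'f::metric_space"
  assumes "prob_space M"
    and "Z \<in> measurable M borel"
    and "\<And>k. k \<in> {1..n} \<Longrightarrow> \<Lambda> k \<in> borel_measurable borel"
    and "\<And>k z. k \<in> {1..n} \<Longrightarrow> \<Lambda> k z \<ge> 0"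
    and "\<alpha> \<in> M_prob_pos"
    and "\<And>k. k \<in> {1..n} \<Longrightarrow> \<beta> k \<in> M_prob_pos"
    and "\<And>f Z'. 1-lipschitz_on UNIV f \<Longrightarrow> indep_copy M Z Z' \<Longrightarrow>
           op_le (survival_op M (\<lambda>\<omega>. \<bar>f (Z \<omega>) - f (Z' \<omega>)\<bar>)) \<alpha>"
    and "\<And>k. k \<in> {1..n} \<Longrightarrow> op_le (survival_op M (\<lambda>\<omega>. \<Lambda> k (Z \<omega>))) (\<beta> k)"
    and "\<And>z z'. dist (\<Phi> z) (\<Phi> z') \<le> (\<Prod>k=1..n. max (\<Lambda> k z) (\<Lambda> k z')) * dist z z'"
  shows "\<forall>(g :: 'f \<Rightarrow> real) Z'. 1-lipschitz_on UNIV g \<longrightarrow> indep_copy M Z Z' \<longrightarrow>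
           survival_le M (\<lambda>\<omega>. \<bar>g (\<Phi> (Z \<omega>)) - g (\<Phi> (Z' \<omega>))\<bar>)
             (op_scale (2 * real n + 1) (foldl (\<boxtimes>) \<alpha> (map \<beta> [1..<n+1])))"
proof (intro allI impI)
  fix g :: "'f \<Rightarrow> real" and Z'
  assume g: "1-lipschitz_on UNIV g" and copy: "indep_copy M Z Z'"
  interpret prob_space M by fact
  note [measurable] = assms(2,3)
  have Z'[measurable]: "Z' \<in> measurable M borel" and law: "distr M borel Z' = distr M borel Z"
    using copy by (simp_all add: indep_copy_def)
  define \<phi> where "\<phi> z = g (\<Phi> z)" for z
  have \<phi>: "dist (\<phi> z) (\<phi> z') \<le> (\<Prod>k=1..n. max (\<Lambda> k z) (\<Lambda> k z')) * dist z z'" for z z'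
    using lipschitz_onD[OF g, of "\<Phi> z" "\<Phi> z'"] assms(9)[of z z'] by (simp add: \<phi>_def)
  \<comment> \<open>No measurability of \<Phi> is assumed; that of \<phi> is extracted from its
    Lipschitz-type estimate.\<close>
  have [measurable]: "\<phi> \<in> borel_measurable borel"
    by (rule borel_measurable_lipschitz_sublevels[of "{1..n}" \<Lambda>]) (use assms(3,4) \<phi> in auto)
  have tail: "\<P>(\<omega> in M. \<bar>\<phi> (Z \<omega>) - \<phi> (Z' \<omega>)\<bar> > a * (\<Prod>k=1..n. b k)) \<le> (2 * real n + 1) * w"
    if a: "w \<in> \<alpha> a" and b: "\<And>k. k \<in> {1..n} \<Longrightarrow> w \<in> \<beta> k (b k)" for w a b
  proof -
    define L where "L = (\<Prod>k=1..n. b k)"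
    define A where "A = {z. \<forall>k\<in>{1..n}. \<Lambda> k z \<le> b k}"
    have \<alpha>: "\<alpha> \<in> M_down" "w \<ge> 0"
      using assms(5) a by (auto simp: M_prob_pos_def op_Ran_def)
    have \<beta>: "\<beta> k \<in> M_down" "b k \<ge> 0" if "k \<in> {1..n}" for k
      using assms(6)[OF that] b[OF that] by (auto simp: M_prob_pos_def op_Dom_def)
    have Lip: "L-lipschitz_on A \<phi>"
      unfolding L_def A_def by (rule lipschitz_on_sublevel[OF assms(4) \<phi> \<beta>(2)])
    obtain h where h: "L-lipschitz_on UNIV h" "\<And>z. z \<in> A \<Longrightarrow> h z = \<phi> z"
      using lipschitz_on_extend_real[OF Lip] by metis
    note [measurable] = borel_measurable_lipschitz[OF h(1)]
    have "{z \<in> space borel. \<forall>k\<in>{1..n}. \<Lambda> k z \<le> b k} \<in> sets borel"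
      by measurable
    then have A[measurable]: "A \<in> sets borel"
      by (simp add: A_def)
    have tail_\<Lambda>: "\<P>(\<omega> in M. \<Lambda> k (Z \<omega>) > b k) \<le> w" if k: "k \<in> {1..n}" for k
    proof -
      have "(\<lambda>\<omega>. \<Lambda> k (Z \<omega>)) \<in> borel_measurable M"
        using k by measurable
      then show ?thesis
        using assms(8)[OF k] b[OF k] \<beta>(1)[OF k] by (simp add: op_le_survival_op_iff)
    qed
    have "\<P>(\<omega> in M. Z \<omega> \<notin> A) \<le> prob (\<Union>k\<in>{1..n}. {\<omega> \<in> space M. \<Lambda> k (Z \<omega>) > b k})"
      by (rule finite_measure_mono) (auto simp: A_def not_le)
    also have "\<dots> \<le> (\<Sum>k=1..n. \<P>(\<omega> in M. \<Lambda> k (Z \<omega>) > b k))"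
      by (rule finite_measure_subadditive_finite) auto
    also have "\<dots> \<le> (\<Sum>k=1..n. w)"
      by (rule sum_mono) (rule tail_\<Lambda>)
    finally have ZA: "\<P>(\<omega> in M. Z \<omega> \<notin> A) \<le> real n * w"
      by simp
    \<comment> \<open>This probability depends only on the law of \<open>Y\<close>, so the bound for
      \<open>Z\<close> passes to the copy \<open>Z'\<close>.\<close>
    have push: "\<P>(\<omega> in M. Y \<omega> \<notin> A) = measure (distr M borel Y) (- A)"
      if [measurable]: "Y \<in> measurable M borel" for Y
      by (subst measure_distr) (auto intro!: arg_cong[where f = prob])
    have Z'A: "\<P>(\<omega> in M. Z' \<omega> \<notin> A) \<le> real n * w"
      using ZA unfolding push[OF Z'] push[OF assms(2)] law .
    have hw: "\<P>(\<omega> in M. \<bar>h (Z \<omega>) - h (Z' \<omega>)\<bar> > a * L) \<le> w"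
    \<comment> \<open>If \<open>L = 0\<close>, then \<open>h\<close> is constant and the event is
      empty. Otherwise \<open>h / L\<close> is 1-Lipschitz and the hypothesis on \<alpha> applies to
      it.\<close>
    proof (cases "L = 0")
      case True
      have "h z = h z'" for z z'
        using lipschitz_onD[OF h(1), of z z'] True by simp
      then have "h (Z \<omega>) - h (Z' \<omega>) = 0" for \<omega>
        by (metis diff_self)
      then show ?thesis
        using True \<alpha>(2) by simp
    next
      case False
      then have L: "L > 0"
        using lipschitz_on_nonneg[OF h(1)] by simp
      have f: "1-lipschitz_on UNIV (\<lambda>z. h z / L)"
      proof (rule lipschitz_onI)
        fix z z'
        show "dist (h z / L) (h z' / L) \<le> 1 * dist z z'"
          using lipschitz_onD[OF h(1), of z z'] L
          by (simp add: dist_real_def flip: diff_divide_distrib) (simp add: field_simps)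
      qed simp
      have "\<P>(\<omega> in M. \<bar>h (Z \<omega>) / L - h (Z' \<omega>) / L\<bar> > a) \<le> w"
        using assms(7)[OF f copy] a \<alpha>(1) by (subst (asm) op_le_survival_op_iff; simp)
      moreover have "\<bar>h (Z \<omega>) / L - h (Z' \<omega>) / L\<bar> > a \<longleftrightarrow> \<bar>h (Z \<omega>) - h (Z' \<omega>)\<bar> > a * L" for \<omega>
        using L by (simp add: pos_less_divide_eq flip: diff_divide_distrib)
      ultimately show ?thesis by simp
    qed
    \<comment> \<open>When both \<open>Z\<close> and \<open>Z'\<close> lie in \<open>A\<close>,
      \<phi> and \<open>h\<close> agree at both points, which gives the inclusion of events.\<close>
    have "\<P>(\<omega> in M. \<bar>\<phi> (Z \<omega>) - \<phi> (Z' \<omega>)\<bar> > a * L)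
        \<le> prob ({\<omega> \<in> space M. \<bar>h (Z \<omega>) - h (Z' \<omega>)\<bar> > a * L} \<union>
            ({\<omega> \<in> space M. Z \<omega> \<notin> A} \<union> {\<omega> \<in> space M. Z' \<omega> \<notin> A}))"
      by (rule finite_measure_mono) (auto simp: h(2))
    also have "\<dots> \<le> \<P>(\<omega> in M. \<bar>h (Z \<omega>) - h (Z' \<omega>)\<bar> > a * L) +
        prob ({\<omega> \<in> space M. Z \<omega> \<notin> A} \<union> {\<omega> \<in> space M. Z' \<omega> \<notin> A})"
      by (rule measure_Un_le) measurable
    also have "prob ({\<omega> \<in> space M. Z \<omega> \<notin> A} \<union> {\<omega> \<in> space M. Z' \<omega> \<notin> A})
        \<le> \<P>(\<omega> in M. Z \<omega> \<notin> A) + \<P>(\<omega> in M. Z' \<omega> \<notin> A)"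
      by (rule measure_Un_le) measurable
    finally show ?thesis
      using hw ZA Z'A by (simp add: L_def algebra_simps)
  qed
  show "survival_le M (\<lambda>\<omega>. \<bar>g (\<Phi> (Z \<omega>)) - g (\<Phi> (Z' \<omega>))\<bar>)
          (op_scale (2 * real n + 1) (foldl (\<boxtimes>) \<alpha> (map \<beta> [1..<n+1])))"
    unfolding \<phi>_def[symmetric]
  proof (rule survival_leI)
    fix t u assume "u \<in> op_scale (2 * real n + 1) (foldl (\<boxtimes>) \<alpha> (map \<beta> [1..<n+1])) t"
    then obtain w where w: "w \<in> foldl (\<boxtimes>) \<alpha> (map \<beta> [1..<n+1]) t" and u: "u = (2 * real n + 1) * w"
      by (auto simp: op_scale_def)
    from foldl_op_par_memD[OF w] obtain a b
      where "w \<in> \<alpha> a" "\<forall>k\<in>{1..n}. w \<in> \<beta> k (b k)" "t = a * (\<Prod>k=1..n. b k)"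
      by blast
    with tail[of w a b] u show "\<P>(\<omega> in M. \<bar>\<phi> (Z \<omega>) - \<phi> (Z' \<omega>)\<bar> > t) \<le> u"
      by simp
  qed measurable
qed

end
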